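(* Let $\varphi$ be an elliptic automorphism of the unit disk $D$ of order $3$ with fixed point $a\in D\setminus\{0\}$. Then $C_\varphi$ is not complex symmetric on $H^2(D)$.
   Context: $D$ is the open unit disk in $\mathbb{C}$; an automorphism of $D$ (a biholomorphic map of $D$ onto itself) is elliptic if it has a unique fixed point in $D$. Its order is the smallest positive integer $n$ such that the $n$-th iterate $\varphi\circ\cdots\circ\varphi$ ($n$ times) is the identity on $D$ (and $\infty$ if no such $n$ exists). $H^2(D)$ is the Hardy space of analytic functions $f$ on $D$ with $\|f\|^2=\sup_{0<r<1}\int_0^{2\pi}|f(re^{i\theta})|^2\frac{d\theta}{2\pi}<\infty$, a Hilbert space. For an analytic self-map $\varphi$ of $D$, $C_\varphi f=f\circ\varphi$ is a bounded operator on $H^2(D)$. A conjugation on a complex Hilbert space $\mathcal{H}$ is a map $C:\mathcal{H}\to\mathcal{H}$ that is conjugate-linear, satisfies $\langle Cx,Cy\rangle=\langle y,x\rangle$ for all $x,y\in\mathcal{H}$, and satisfies $C^2=I$. A bounded operator $T$ on $\mathcal{H}$ is complex symmetric if there exists a conjugation $C$ on $\mathcal{H}$ with $T=CT^*C$. *)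

theory Defs
  imports "HOL-Complex_Analysis.Complex_Analysis" "HOL-Library.Extended_Nat"
begin

section \<open>Automorphisms of the unit disk\<close>

abbreviation unit_disk :: "complex set" where
  "unit_disk \<equiv> ball 0 1"

text \<open>
  A self-map of the disk is a function on all of the complex numbers of which only the values on
  the disk are ever used.
\<close>

definition disk_automorphism :: "(complex \<Rightarrow> complex) \<Rightarrow> bool" where
  "disk_automorphism \<phi> \<longleftrightarrow>
     \<phi> holomorphic_on unit_disk \<and>
     bij_betw \<phi> unit_disk unit_disk \<and>
     inv_into unit_disk \<phi> holomorphic_on unit_disk"

definition elliptic_automorphism :: "(complex \<Rightarrow> complex) \<Rightarrow> bool" where
  "elliptic_automorphism \<phi> \<longleftrightarrow>
     disk_automorphism \<phi> \<and> (\<exists>!z. z \<in> unit_disk \<and> \<phi> z = z)"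

definition disk_order :: "(complex \<Rightarrow> complex) \<Rightarrow> enat" where
  "disk_order \<phi> =
     (if \<exists>n::nat. 0 < n \<and> (\<forall>z\<in>unit_disk. (\<phi> ^^ n) z = z)
      then enat (LEAST n::nat. 0 < n \<and> (\<forall>z\<in>unit_disk. (\<phi> ^^ n) z = z))
      else \<infinity>)"


section \<open>Conjugations and complex symmetric operators\<close>

text \<open>
  The Hilbert space is given by a carrier \<open>H\<close> of complex-valued functions, a vector space under the
  pointwise operations, together with an inner product \<open>ip\<close> that is linear in its first argument.
  Operators on it are functions of which only the values on \<open>H\<close> matter.
\<close>

definition conjugation_on ::
  "('a \<Rightarrow> complex) set \<Rightarrow> (('a \<Rightarrow> complex) \<Rightarrow> ('a \<Rightarrow> complex) \<Rightarrow> complex) \<Rightarrow>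
   (('a \<Rightarrow> complex) \<Rightarrow> ('a \<Rightarrow> complex)) \<Rightarrow> bool" where
  "conjugation_on H ip C \<longleftrightarrow>
     (\<forall>x\<in>H. C x \<in> H) \<and>
     (\<forall>x\<in>H. \<forall>y\<in>H. C (\<lambda>t. x t + y t) = (\<lambda>t. C x t + C y t)) \<and>
     (\<forall>c. \<forall>x\<in>H. C (\<lambda>t. c * x t) = (\<lambda>t. cnj c * C x t)) \<and>
     (\<forall>x\<in>H. \<forall>y\<in>H. ip (C x) (C y) = ip y x) \<and>
     (\<forall>x\<in>H. C (C x) = x)"

text \<open>
  The adjoint as a relation: on a Hilbert space every bounded \<open>T\<close> has an adjoint \<open>S\<close>, and the
  values of \<open>S\<close> on \<open>H\<close> are uniquely determined.
\<close>

definition is_adjoint_on ::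
  "('a \<Rightarrow> complex) set \<Rightarrow> (('a \<Rightarrow> complex) \<Rightarrow> ('a \<Rightarrow> complex) \<Rightarrow> complex) \<Rightarrow>
   (('a \<Rightarrow> complex) \<Rightarrow> ('a \<Rightarrow> complex)) \<Rightarrow> (('a \<Rightarrow> complex) \<Rightarrow> ('a \<Rightarrow> complex)) \<Rightarrow> bool" where
  "is_adjoint_on H ip T S \<longleftrightarrow>
     (\<forall>y\<in>H. S y \<in> H) \<and> (\<forall>x\<in>H. \<forall>y\<in>H. ip (T x) y = ip x (S y))"

text \<open>
  This is \<open>T = C T\<^sup>* C\<close> for some conjugation \<open>C\<close>.  Boundedness of \<open>T\<close> is not a separate conjunct: by
  the closed graph theorem, an operator with an everywhere defined adjoint is bounded.
\<close>

definition complex_symmetric_on ::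
  "('a \<Rightarrow> complex) set \<Rightarrow> (('a \<Rightarrow> complex) \<Rightarrow> ('a \<Rightarrow> complex) \<Rightarrow> complex) \<Rightarrow>
   (('a \<Rightarrow> complex) \<Rightarrow> ('a \<Rightarrow> complex)) \<Rightarrow> bool" where
  "complex_symmetric_on H ip T \<longleftrightarrow>
     (\<exists>C S. conjugation_on H ip C \<and> is_adjoint_on H ip T S \<and> (\<forall>x\<in>H. T x = C (S (C x))))"


section \<open>The Hardy space of the disk\<close>

definition circle_mean :: "(complex \<Rightarrow> complex) \<Rightarrow> real \<Rightarrow> real" where
  "circle_mean f r =
     integral {0..2 * pi} (\<lambda>\<theta>. (cmod (f (complex_of_real r * cis \<theta>)))\<^sup>2) / (2 * pi)"

text \<open>
  Elements of the Hardy space are set to \<open>0\<close> off the disk, so that they are equal as functions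
  iff they agree on the disk, and the carrier is closed under the pointwise operations.
\<close>

definition hardy_space :: "(complex \<Rightarrow> complex) set" where
  "hardy_space =
     {f. f holomorphic_on unit_disk \<and>
         bdd_above (circle_mean f ` {0<..<1}) \<and>
         (\<forall>z. z \<notin> unit_disk \<longrightarrow> f z = 0)}"

definition hardy_norm :: "(complex \<Rightarrow> complex) \<Rightarrow> real" where
  "hardy_norm f = sqrt (SUP r\<in>{0<..<1}. circle_mean f r)"

text \<open>
  The inner product inducing the Hardy norm, linear in the first argument, is recovered from that
  norm by the polarization identity.
\<close>

definition hardy_inner :: "(complex \<Rightarrow> complex) \<Rightarrow> (complex \<Rightarrow> complex) \<Rightarrow> complex" where
  "hardy_inner f g =
     (\<Sum>k<4. \<i> ^ k * complex_of_real ((hardy_norm (\<lambda>z. f z + \<i> ^ k * g z))\<^sup>2)) / 4"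

definition composition_operator ::
  "(complex \<Rightarrow> complex) \<Rightarrow> (complex \<Rightarrow> complex) \<Rightarrow> (complex \<Rightarrow> complex)" where
  "composition_operator \<phi> f = (\<lambda>z. if z \<in> unit_disk then f (\<phi> z) else 0)"

end

theory Submission imports Defs begin

text \<open>
  Let \<open>T\<close> be the composition operator, \<open>b = \<phi> 0\<close>, \<open>c = \<phi> (\<phi> 0)\<close> and \<open>r = |b| = |c|\<close>. If \<open>C\<close> is a
  conjugation with \<open>T = C T\<^sup>* C\<close>, then \<open>g = C f\<close> satisfies
  \<open>\<parallel>T\<^sup>2 f\<parallel>\<^sup>2 - \<parallel>T f\<parallel>\<^sup>2 = \<parallel>T\<^sup>*\<^sup>2 g\<parallel>\<^sup>2 - \<parallel>T\<^sup>* g\<parallel>\<^sup>2\<close> and \<open>\<parallel>g\<parallel> = \<parallel>f\<parallel>\<close>. As \<open>T\<^sup>2\<close> is composition with \<open>\<phi>\<^sup>-\<^sup>1\<close>, the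
  operators \<open>T\<^sup>* T\<close> and \<open>T\<^sup>*\<^sup>2 T\<^sup>2\<close> are the Toeplitz operators whose symbols are the Poisson kernels
  at \<open>b\<close> and \<open>c\<close>, so on normalized Szego kernels the left-hand side comes arbitrarily close to
  any value of the difference of these two Poisson kernels on the circle. Likewise \<open>T T\<^sup>*\<close> and
  \<open>T\<^sup>2 T\<^sup>*\<^sup>2\<close> are tridiagonal, with identical diagonals because \<open>|b| = |c|\<close>, so the right-hand side is at
  most \<open>2 |c - b| / (1 - r\<^sup>2)\<close> times the squared norm of \<open>g\<close>. The Poisson kernels differ by more than that
  at some point of the circle, unless \<open>b / c\<close> is real. But \<open>\<phi>\<^sup>3 = id\<close> makes the real part of
  \<open>b / c\<close> equal to \<open>(1 + r\<^sup>2) / 2\<close>, and \<open>b / c\<close> has modulus one.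
\<close>

section \<open>The Hardy space in terms of Taylor coefficients\<close>

lemma integral_cis_int:
  fixes k :: int
  shows "((\<lambda>\<theta>. cis (of_int k * \<theta>)) has_integral (if k = 0 then 2 * pi else 0)) {0..2 * pi}"
proof (cases "k = 0")
  case True
  then show ?thesis
    using has_integral_const_real[of "1::complex" 0 "2 * pi"] by (simp add: scaleR_conv_of_real)
next
  case False
  define F where "F \<theta> = cis (of_int k * \<theta>) / (\<i> * of_int k)" for \<theta> :: real
  have "(F has_vector_derivative cis (of_int k * x)) (at x within {0..2 * pi})" for x
  proof -
    have "((\<lambda>x. cis (of_int k * x)) has_vector_derivative of_int k *\<^sub>R (\<i> * cis (of_int k * x))) (at x within {0..2 * pi})"
      unfolding has_vector_derivative_def
      by (auto intro!: derivative_eq_intros simp: scaleR_conv_of_real)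
    from has_vector_derivative_divide[OF this, of "\<i> * of_int k"]
    show ?thesis using False by (simp add: F_def[abs_def] scaleR_conv_of_real)
  qed
  then have "((\<lambda>\<theta>. cis (of_int k * \<theta>)) has_integral F (2 * pi) - F 0) {0..2 * pi}"
    by (intro fundamental_theorem_of_calculus) auto
  moreover have "cis (of_int k * (2 * pi)) = 1"
    using cis_multiple_2pi[of "of_int k"] by (simp add: mult_ac)
  ultimately show ?thesis
    using False by (simp add: F_def)
qed

lemma circle_mean_polynomial:
  fixes A :: "nat \<Rightarrow> complex"
  shows "((\<lambda>\<theta>. (cmod (\<Sum>n<N. A n * (complex_of_real r * cis \<theta>) ^ n))\<^sup>2)
           has_integral 2 * pi * (\<Sum>n<N. (cmod (A n))\<^sup>2 * r ^ (2 * n))) {0..2 * pi}"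
proof -
  let ?c = "\<lambda>n m. A n * cnj (A m) * of_real (r ^ (n + m))"
  have eq: "complex_of_real ((cmod (\<Sum>n<N. A n * (of_real r * cis \<theta>) ^ n))\<^sup>2)
      = (\<Sum>n<N. \<Sum>m<N. ?c n m * cis (of_int (int n - int m) * \<theta>))" for \<theta>
    unfolding complex_norm_square cnj_sum sum_product
    by (intro sum.cong refl)
       (simp add: power_mult_distrib Complex.DeMoivre power_add algebra_simps cis_cnj cis_mult)
  have "((\<lambda>\<theta>. \<Sum>n<N. \<Sum>m<N. ?c n m * cis (of_int (int n - int m) * \<theta>)) has_integral
      (\<Sum>n<N. \<Sum>m<N. ?c n m * (if int n - int m = 0 then 2 * pi else 0))) {0..2 * pi}"
    by (intro has_integral_sum finite_lessThan has_integral_mult_right integral_cis_int)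
  also have "(\<Sum>n<N. \<Sum>m<N. ?c n m * (if int n - int m = 0 then 2 * pi else 0))
      = (\<Sum>n<N. \<Sum>m<N. if n = m then ?c n n * (2 * pi) else 0)"
    by (intro sum.cong refl) auto
  also have "\<dots> = complex_of_real (2 * pi * (\<Sum>n<N. (cmod (A n))\<^sup>2 * r ^ (2 * n)))"
  proof -
    have "?c n n * (2 * pi) = complex_of_real (2 * pi * ((cmod (A n))\<^sup>2 * r ^ (2 * n)))" for n
      unfolding of_real_mult[of _ "_ * _"] of_real_mult[of "_\<^sup>2"] complex_norm_square mult_2 by simp
    then show ?thesis
      unfolding sum_distrib_left of_real_sum by (intro sum.cong) auto
  qed
  finally have "((\<lambda>\<theta>. complex_of_real ((cmod (\<Sum>n<N. A n * (of_real r * cis \<theta>) ^ n))\<^sup>2))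
      has_integral complex_of_real (2 * pi * (\<Sum>n<N. (cmod (A n))\<^sup>2 * r ^ (2 * n)))) {0..2 * pi}"
    by (simp only: eq)
  from has_integral_linear[OF this bounded_linear_Re] show ?thesis
    by (simp add: o_def)
qed

text \<open>Parseval for the whole series: the partial sums converge uniformly on the closed disk of
  radius \<open>r\<close>, so the limit passes through the integral in
  \<open>circle_mean_polynomial\<close>.\<close>

lemma circle_mean_power_series:
  assumes f: "\<And>z. z \<in> unit_disk \<Longrightarrow> (\<lambda>n. A n * z ^ n) sums f z" and r: "0 < r" "r < 1"
  shows "(\<lambda>n. (cmod (A n))\<^sup>2 * r ^ (2 * n)) sums circle_mean f r"
proof -
  let ?p = "\<lambda>N z. \<Sum>n<N. A n * z ^ n"
  \<comment> \<open>Uniform convergence needs \<open>r\<close> strictly below the convergence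
    radius; the midpoint \<open>(1 + r) / 2\<close> provides the room.\<close>
  have "ereal s \<le> conv_radius A" if "0 < s" "s < 1" for s :: real
    using f[of "of_real s"] that conv_radius_geI[of A "of_real s"] by (auto dest: sums_summable)
  from less_le_trans[OF _ this[of "(1 + r) / 2"], of "ereal r"] have "ereal r < conv_radius A"
    using r by simp
  from powser_uniform_limit[OF this, of 0]
  have "uniform_limit (cball 0 r) ?p (\<lambda>z. \<Sum>n. A n * z ^ n) sequentially" by simp
  also have "?this \<longleftrightarrow> uniform_limit (cball 0 r) ?p f sequentially"
    using r by (intro uniform_limit_cong') (auto intro!: sums_unique[symmetric] f)
  finally have lim: "uniform_limit (cball 0 r) ?p f sequentially" .
  \<comment> \<open>A product of uniform limits is a uniform limit only for bounded factors;
    compactness of the closed disk supplies the bound for the squared moduli.\<close>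
  have "continuous_on (cball 0 r) f"
    by (rule uniform_limit_theorem[OF _ lim]) (auto intro!: continuous_intros always_eventually)
  then have "continuous_on (cball 0 r) (\<lambda>z. cmod (f z))"
    by (intro continuous_intros)
  then have bdd: "bounded ((\<lambda>z. cmod (f z)) ` cball 0 r)"
    by (intro compact_imp_bounded compact_continuous_image) auto
  have "uniform_limit (cball 0 r) (\<lambda>N z. cmod (?p N z) * cmod (?p N z)) (\<lambda>z. cmod (f z) * cmod (f z)) sequentially"
    by (intro uniform_lim_mult uniform_limit_intros lim bdd)
  then have "uniform_limit {0..2 * pi} (\<lambda>N \<theta>. (cmod (?p N (of_real r * cis \<theta>)))\<^sup>2)
      (\<lambda>\<theta>. (cmod (f (of_real r * cis \<theta>)))\<^sup>2) sequentially"
    unfolding power2_eq_square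
    by (rule uniform_limit_compose') (use r in \<open>auto simp: norm_mult\<close>)
  moreover have "continuous_on {0..2 * pi} (\<lambda>\<theta>. (cmod (?p N (of_real r * cis \<theta>)))\<^sup>2)" for N
    by (intro continuous_intros)
  ultimately obtain I J where I: "\<And>N. ((\<lambda>\<theta>. (cmod (?p N (of_real r * cis \<theta>)))\<^sup>2) has_integral I N) {0..2 * pi}"
    and J: "((\<lambda>\<theta>. (cmod (f (of_real r * cis \<theta>)))\<^sup>2) has_integral J) {0..2 * pi}"
    and IJ: "I \<longlonglongrightarrow> J"
    by (rule uniform_limit_integral) auto
  have "I N = 2 * pi * (\<Sum>n<N. (cmod (A n))\<^sup>2 * r ^ (2 * n))" for N
    using I circle_mean_polynomial by (rule has_integral_unique)
  with tendsto_divide[OF IJ tendsto_const[of "2 * pi"]]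
  have "(\<lambda>N. \<Sum>n<N. (cmod (A n))\<^sup>2 * r ^ (2 * n)) \<longlonglongrightarrow> J / (2 * pi)"
    by simp
  then show ?thesis
    using J by (simp add: sums_def circle_mean_def integral_unique)
qed

text \<open>The identification of the Hardy space with square-summable sequences, kept as a relation
  so that sums, multiples and shifts can be tracked on function and coefficients at once.\<close>

definition hardy_series :: "(complex \<Rightarrow> complex) \<Rightarrow> (nat \<Rightarrow> complex) \<Rightarrow> bool" where
  "hardy_series f A \<longleftrightarrow> (\<forall>z\<in>unit_disk. (\<lambda>n. A n * z ^ n) sums f z) \<and>
     (\<forall>z. z \<notin> unit_disk \<longrightarrow> f z = 0) \<and> summable (\<lambda>n. (cmod (A n))\<^sup>2)"

lemma hardy_series_circle_mean:
  assumes "hardy_series f A" "0 < r" "r < 1"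
  shows "circle_mean f r \<le> (\<Sum>n. (cmod (A n))\<^sup>2)"
proof -
  have s: "(\<lambda>n. (cmod (A n))\<^sup>2 * r ^ (2 * n)) sums circle_mean f r"
    using assms by (intro circle_mean_power_series) (auto simp: hardy_series_def)
  show ?thesis
    using s assms by (intro sums_le[OF _ s summable_sums])
      (auto simp: hardy_series_def intro!: mult_left_le power_le_one)
qed

text \<open>Letting \<open>r\<close> tend to 1 in a finite sum needs no exchange of limits; the tail
  is dropped beforehand because its terms are nonnegative.\<close>

lemma partial_sum_le_circle_mean_bound:
  assumes f: "\<And>z. z \<in> unit_disk \<Longrightarrow> (\<lambda>n. A n * z ^ n) sums f z"
    and le: "\<And>r. 0 < r \<Longrightarrow> r < 1 \<Longrightarrow> circle_mean f r \<le> M"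
  shows "(\<Sum>n<N. (cmod (A n))\<^sup>2) \<le> M"
proof -
  have "((\<lambda>r. \<Sum>n<N. (cmod (A n))\<^sup>2 * r ^ (2 * n)) \<longlongrightarrow> (\<Sum>n<N. (cmod (A n))\<^sup>2 * 1 ^ (2 * n))) (at_left (1::real))"
    by (intro tendsto_intros)
  moreover have "\<forall>\<^sub>F r in at_left (1::real). (\<Sum>n<N. (cmod (A n))\<^sup>2 * r ^ (2 * n)) \<le> M"
  proof (rule eventually_at_leftI[of 0])
    fix r :: real assume "r \<in> {0<..<1}"
    then have r: "0 < r" "r < 1" by auto
    have s: "(\<lambda>n. (cmod (A n))\<^sup>2 * r ^ (2 * n)) sums circle_mean f r"
      by (rule circle_mean_power_series[OF f r])
    show "(\<Sum>n<N. (cmod (A n))\<^sup>2 * r ^ (2 * n)) \<le> M"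
      using sum_le_suminf[OF sums_summable[OF s], of "{..<N}"] sums_unique[OF s] le[OF r] r
      by auto
  qed auto
  ultimately have "(\<Sum>n<N. (cmod (A n))\<^sup>2 * 1 ^ (2 * n)) \<le> M"
    by (rule tendsto_upperbound) auto
  then show ?thesis by simp
qed

lemma hardy_norm_series:
  assumes "hardy_series f A"
  shows "(hardy_norm f)\<^sup>2 = (\<Sum>n. (cmod (A n))\<^sup>2)"
proof -
  let ?M = "SUP r\<in>{0<..<1}. circle_mean f r"
  have bdd: "bdd_above (circle_mean f ` {0<..<1})"
    using hardy_series_circle_mean[OF assms] by (auto intro!: bdd_aboveI2)
  have "?M \<le> (\<Sum>n. (cmod (A n))\<^sup>2)"
    using hardy_series_circle_mean[OF assms] by (intro cSUP_least) auto
  moreover have "(\<Sum>n<N. (cmod (A n))\<^sup>2) \<le> ?M" for N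
    by (rule partial_sum_le_circle_mean_bound)
       (use assms in \<open>auto simp: hardy_series_def intro!: cSUP_upper bdd\<close>)
  then have "(\<Sum>n. (cmod (A n))\<^sup>2) \<le> ?M"
    using assms by (intro suminf_le_const) (auto simp: hardy_series_def)
  ultimately have "?M = (\<Sum>n. (cmod (A n))\<^sup>2)" by simp
  then show ?thesis
    using assms by (auto simp: hardy_norm_def hardy_series_def intro!: real_sqrt_pow2 suminf_nonneg)
qed

lemma hardy_space_iff: "f \<in> hardy_space \<longleftrightarrow> (\<exists>A. hardy_series f A)"
proof
  assume f: "f \<in> hardy_space"
  define A where "A n = (deriv ^^ n) f 0 / fact n" for n
  have A: "(\<lambda>n. A n * z ^ n) sums f z" if "z \<in> unit_disk" for z
    using holomorphic_power_series[of f 0 1 z] f that by (simp add: hardy_space_def A_def)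
  have "(\<Sum>n<N. (cmod (A n))\<^sup>2) \<le> (SUP r\<in>{0<..<1}. circle_mean f r)" for N
    by (rule partial_sum_le_circle_mean_bound[OF A])
       (use f in \<open>auto simp: hardy_space_def intro!: cSUP_upper\<close>)
  then have "summable (\<lambda>n. (cmod (A n))\<^sup>2)"
    by (intro summableI_nonneg_bounded) auto
  with A f have "hardy_series f A"
    by (auto simp: hardy_series_def hardy_space_def)
  then show "\<exists>A. hardy_series f A" by blast
next
  assume "\<exists>A. hardy_series f A"
  then obtain A where A: "hardy_series f A" ..
  have "f holomorphic_on unit_disk"
    using A by (intro power_series_holomorphic[of 0 1 A]) (auto simp: hardy_series_def)
  then show "f \<in> hardy_space"
    using A hardy_series_circle_mean[OF A]
    by (auto simp: hardy_series_def hardy_space_def intro!: bdd_aboveI2)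
qed

section \<open>Operations on coefficient sequences and the inner product\<close>

lemma summable_mult_of_square:
  fixes A B :: "nat \<Rightarrow> complex"
  assumes "summable (\<lambda>n. (cmod (A n))\<^sup>2)" "summable (\<lambda>n. (cmod (B n))\<^sup>2)"
  shows "summable (\<lambda>n. A n * B n)"
proof (rule summable_comparison_test')
  show "summable (\<lambda>n. (cmod (A n))\<^sup>2 + (cmod (B n))\<^sup>2)"
    using assms by (rule summable_add)
  show "norm (A n * B n) \<le> (cmod (A n))\<^sup>2 + (cmod (B n))\<^sup>2" for n
    using sum_squares_bound[of "cmod (A n)" "cmod (B n)"]
      mult_nonneg_nonneg[OF norm_ge_zero norm_ge_zero, of "A n" "B n"]
    unfolding norm_mult by linarith
qed

lemma hardy_series_cmult:
  assumes "hardy_series f A"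
  shows "hardy_series (\<lambda>z. c * f z) (\<lambda>n. c * A n)"
  using assms sums_mult[of _ _ c]
  by (simp add: hardy_series_def norm_mult power_mult_distrib mult.assoc summable_mult)

lemma hardy_series_add:
  assumes "hardy_series f A" "hardy_series g B"
  shows "hardy_series (\<lambda>z. f z + g z) (\<lambda>n. A n + B n)"
proof -
  have "summable (\<lambda>n. 2 * (cmod (A n))\<^sup>2 + 2 * (cmod (B n))\<^sup>2)"
    using assms by (auto simp: hardy_series_def intro!: summable_add summable_mult)
  then have "summable (\<lambda>n. (cmod (A n + B n))\<^sup>2)"
  proof (rule summable_comparison_test')
    fix n
    have "(cmod (A n + B n))\<^sup>2 \<le> (cmod (A n) + cmod (B n))\<^sup>2"
      by (intro power_mono norm_triangle_ineq) auto
    also have "\<dots> \<le> 2 * (cmod (A n))\<^sup>2 + 2 * (cmod (B n))\<^sup>2"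
      using sum_squares_bound[of "cmod (A n)" "cmod (B n)"] by (simp add: power2_sum)
    finally show "norm ((cmod (A n + B n))\<^sup>2) \<le> 2 * (cmod (A n))\<^sup>2 + 2 * (cmod (B n))\<^sup>2"
      by simp
  qed
  with assms show ?thesis
    by (auto simp: hardy_series_def distrib_right intro!: sums_add)
qed

lemma polarization:
  fixes a b :: complex
  shows "(\<Sum>k<4. \<i> ^ k * complex_of_real ((cmod (a + \<i> ^ k * b))\<^sup>2)) / 4 = a * cnj b"
proof -
  have "{..<4::nat} = {0, 1, 2, 3}" by auto
  then show ?thesis
    unfolding complex_norm_square by (simp add: power3_eq_cube) (simp add: algebra_simps)
qed

text \<open>Each of the four squared norms in the polarization formula is a sum over coefficients,
  so the formula can be applied coefficient by coefficient.\<close>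

lemma hardy_inner_series:
  assumes f: "hardy_series f A" and g: "hardy_series g B"
  shows "(\<lambda>n. A n * cnj (B n)) sums hardy_inner f g"
proof -
  have "(\<lambda>n. complex_of_real ((cmod (A n + \<i> ^ k * B n))\<^sup>2))
      sums complex_of_real ((hardy_norm (\<lambda>z. f z + \<i> ^ k * g z))\<^sup>2)" for k
  proof -
    have s: "hardy_series (\<lambda>z. f z + \<i> ^ k * g z) (\<lambda>n. A n + \<i> ^ k * B n)"
      by (intro hardy_series_add hardy_series_cmult f g)
    show ?thesis
      unfolding hardy_norm_series[OF s]
      using s by (intro sums_of_real summable_sums) (simp add: hardy_series_def)
  qed
  then have "(\<lambda>n. (\<Sum>k<4. \<i> ^ k * complex_of_real ((cmod (A n + \<i> ^ k * B n))\<^sup>2)) / 4) sums hardy_inner f g"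
    unfolding hardy_inner_def by (intro sums_divide sums_sum sums_mult)
  then show ?thesis
    unfolding polarization .
qed

text \<open>The bound on \<open>z\<close> is not strict because denominators are also evaluated at
  points of the unit circle.\<close>

lemma one_minus_cnj_mult_nonzero:
  assumes "cmod w < 1" "cmod z \<le> 1"
  shows "1 - cnj w * z \<noteq> 0"
proof -
  have "cmod (cnj w * z) < 1"
    using assms mult_left_le[of "cmod z" "cmod w"] by (simp add: norm_mult)
  then show ?thesis
    by (metis norm_one less_irrefl right_minus_eq)
qed

lemma summable_square_power:
  assumes "cmod z < 1"
  shows "summable (\<lambda>n. (cmod (z ^ n))\<^sup>2)"
proof -
  have "summable (\<lambda>n. ((cmod z)\<^sup>2) ^ n)"
    using assms by (intro summable_geometric) (simp add: abs_square_less_1)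
  then show ?thesis
    by (simp add: norm_power power_mult[symmetric] mult.commute)
qed

text \<open>This turns the shifted coefficients of a Hardy function into a function again, which is
  how the backward shift enters.\<close>

lemma hardy_series_exists:
  assumes "summable (\<lambda>n. (cmod (A n))\<^sup>2)"
  obtains f where "hardy_series f A"
proof
  have "summable (\<lambda>n. A n * z ^ n)" if "cmod z < 1" for z
    by (intro summable_mult_of_square assms summable_square_power that)
  then show "hardy_series (\<lambda>z. if z \<in> unit_disk then \<Sum>n. A n * z ^ n else 0) A"
    using assms by (auto simp: hardy_series_def intro!: summable_sums)
qed

lemma hardy_series_shift:
  assumes "hardy_series f A"
  shows "hardy_series (\<lambda>z. z * f z) (\<lambda>n. if n = 0 then 0 else A (n - 1))"
proof -
  have "(\<lambda>n. (if n = 0 then 0 else A (n - 1)) * z ^ n) sums (z * f z)" if "z \<in> unit_disk" for z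
  proof (rule sums_Suc_imp)
    show "(\<lambda>n. (if Suc n = 0 then 0 else A (Suc n - 1)) * z ^ Suc n) sums (z * f z)"
      using assms that sums_mult[of "\<lambda>n. A n * z ^ n" "f z" z] by (simp add: hardy_series_def mult_ac)
  qed simp
  moreover have "summable (\<lambda>n. (cmod (if n = 0 then 0 else A (n - 1)))\<^sup>2)"
    using assms by (subst summable_Suc_iff[symmetric]) (simp add: hardy_series_def)
  ultimately show ?thesis
    using assms by (simp add: hardy_series_def)
qed

lemma hardy_inner_commute:
  assumes "f \<in> hardy_space" "g \<in> hardy_space"
  shows "hardy_inner g f = cnj (hardy_inner f g)"
proof -
  obtain A B where A: "hardy_series f A" and B: "hardy_series g B"
    using assms by (auto simp: hardy_space_iff)
  have "(\<lambda>n. cnj (A n * cnj (B n))) sums cnj (hardy_inner f g)"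
    using hardy_inner_series[OF A B] by (simp only: sums_cnj)
  then show ?thesis
    using hardy_inner_series[OF B A] by (simp add: sums_unique2 mult.commute)
qed

text \<open>The reproducing kernel of the Hardy space, cut off outside the disk as membership in
  \<open>hardy_space\<close> demands.\<close>

definition szego :: "complex \<Rightarrow> complex \<Rightarrow> complex" where
  "szego w z = (if z \<in> unit_disk then 1 / (1 - cnj w * z) else 0)"

lemma hardy_series_szego:
  assumes "cmod w < 1"
  shows "hardy_series (szego w) (\<lambda>n. cnj w ^ n)"
proof -
  have "(\<lambda>n. cnj w ^ n * z ^ n) sums szego w z" if "cmod z < 1" for z
    using geometric_sums[of "cnj w * z"] norm_mult_less[of "cnj w" 1 z 1] assms that
    by (simp add: szego_def power_mult_distrib)
  moreover have "summable (\<lambda>n. (cmod (cnj w ^ n))\<^sup>2)"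
    by (rule summable_square_power) (simp add: assms)
  ultimately show ?thesis
    by (simp add: hardy_series_def szego_def)
qed

lemma hardy_inner_szego:
  assumes "f \<in> hardy_space" "cmod w < 1"
  shows "hardy_inner f (szego w) = f w"
proof -
  obtain A where A: "hardy_series f A"
    using assms by (auto simp: hardy_space_iff)
  have "(\<lambda>n. A n * w ^ n) sums f w"
    using A assms by (simp add: hardy_series_def)
  then show ?thesis
    using hardy_inner_series[OF A hardy_series_szego[OF assms(2)]] by (simp add: sums_unique2)
qed


section \<open>Automorphisms of the disk\<close>

definition disk_moebius_on :: "complex \<Rightarrow> complex \<Rightarrow> (complex \<Rightarrow> complex) \<Rightarrow> bool" where
  "disk_moebius_on l c \<phi> \<longleftrightarrow> cmod l = 1 \<and> cmod c < 1 \<and>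
     (\<forall>z\<in>unit_disk. \<phi> z = l * (z - c) / (1 - cnj c * z))"

text \<open>Moving the zero \<open>c\<close> to the origin gives a map \<open>F\<close> fixing 0
  whose inverse \<open>G\<close> also fixes 0. By the Schwarz lemma neither increases moduli, so
  \<open>F\<close> preserves them and is a rotation.\<close>

lemma disk_automorphism_eq_moebius:
  assumes "disk_automorphism \<phi>" and c: "c \<in> unit_disk" "\<phi> c = 0"
  obtains l where "disk_moebius_on l c \<phi>"
proof -
  define \<psi> where "\<psi> = inv_into unit_disk \<phi>"
  define M where "M w z = (z - w) / (1 - cnj w * z)" for w z :: complex
  note M_def' = M_def[abs_def, folded Moebius_function_simple]
  have hol: "\<phi> holomorphic_on unit_disk" "\<psi> holomorphic_on unit_disk"
    and bij: "bij_betw \<phi> unit_disk unit_disk"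
    using assms(1) by (auto simp: disk_automorphism_def \<psi>_def)
  have M: "M w holomorphic_on unit_disk" "M w \<in> unit_disk \<rightarrow> unit_disk" if "w \<in> unit_disk" for w
    using Moebius_function_holomorphic[of w 0] Moebius_function_norm_lt_1[of w _ 0] that
    by (auto simp: M_def')
  have MM: "M w (M (- w) z) = z" "M (- w) (M w z) = z" if "w \<in> unit_disk" "z \<in> unit_disk" for w z
    using Moebius_function_compose[of w "- w" z] Moebius_function_compose[of "- w" w z] that
    by (auto simp: M_def')
  have \<phi>: "\<phi> \<in> unit_disk \<rightarrow> unit_disk" and \<psi>: "\<psi> \<in> unit_disk \<rightarrow> unit_disk"
    and \<phi>\<psi>: "\<And>z. z \<in> unit_disk \<Longrightarrow> \<phi> (\<psi> z) = z" and \<psi>\<phi>: "\<And>z. z \<in> unit_disk \<Longrightarrow> \<psi> (\<phi> z) = z"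
    using bij bij_betw_inv_into[OF bij] bij_betw_inv_into_left[OF bij] bij_betw_inv_into_right[OF bij]
    by (auto simp: \<psi>_def bij_betw_def)
  have c': "- c \<in> unit_disk" and M0: "M c c = 0" "M (- c) 0 = c" using c by (auto simp: M_def)
  define F where "F = \<phi> \<circ> M (- c)"
  define G where "G = M c \<circ> \<psi>"
  have F: "F holomorphic_on unit_disk" "F 0 = 0" "\<And>z. cmod z < 1 \<Longrightarrow> cmod (F z) < 1"
    unfolding F_def using M[OF c'] hol \<phi> M0 c
    by (auto intro!: holomorphic_on_compose_gen[where t = unit_disk] simp: Pi_iff)
  have "\<psi> 0 = c" using \<psi>\<phi>[OF c(1)] c(2) by simp
  then have G: "G holomorphic_on unit_disk" "G 0 = 0" "\<And>z. cmod z < 1 \<Longrightarrow> cmod (G z) < 1"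
    unfolding G_def using M[OF c(1)] hol \<psi> M0 c
    by (auto intro!: holomorphic_on_compose_gen[where t = unit_disk] simp: Pi_iff)
  have GF: "G (F z) = z" if "cmod z < 1" for z
    using that MM(1)[OF c(1), of z] \<psi>\<phi> M(2)[OF c'] by (auto simp: F_def G_def Pi_iff)
  \<comment> \<open>The equality case of the Schwarz lemma needs one nonzero point;
    \<open>1/2\<close> is an arbitrary choice.\<close>
  have z: "cmod (1/2 :: complex) < 1" by simp
  have "cmod (F (1/2)) = cmod (1/2 :: complex)"
    using Schwarz_Lemma(1)[OF F z] Schwarz_Lemma(1)[OF G F(3)[OF z]] GF[OF z] by simp
  then have "\<exists>z. cmod z < 1 \<and> z \<noteq> 0 \<and> cmod (F z) = cmod z"
    by (intro exI[of _ "1/2"]) simp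
  with Schwarz_Lemma(3)[OF F z] obtain l where l: "\<And>z. cmod z < 1 \<Longrightarrow> F z = l * z" "cmod l = 1"
    by blast
  have "\<phi> z = l * (z - c) / (1 - cnj c * z)" if z: "z \<in> unit_disk" for z
  proof -
    have "\<phi> z = F (M c z)"
      using MM(2)[OF c(1) z] by (simp add: F_def)
    also have "\<dots> = l * M c z"
      using M(2)[OF c(1)] z by (intro l) (auto simp: Pi_iff)
    finally show ?thesis
      by (simp add: M_def)
  qed
  with l c(1) have "disk_moebius_on l c \<phi>"
    by (simp add: disk_moebius_on_def)
  then show thesis by (rule that)
qed

text \<open>The two-point form of the Schwarz-Pick identity. It turns a Szego kernel composed with
  \<phi> into a Szego kernel times a linear polynomial.\<close>

lemma disk_moebius_kernel:
  assumes "disk_moebius_on l c \<phi>" and v: "cmod v < 1" and z: "cmod z < 1"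
  shows "1 - cnj (\<phi> v) * \<phi> z = (1 - c * cnj c) * (1 - cnj v * z) / ((1 - c * cnj v) * (1 - cnj c * z))"
proof -
  have c: "cmod c < 1" and l: "cnj l * l = 1"
    using assms(1) complex_norm_square[of l] by (auto simp: disk_moebius_on_def mult.commute)
  have nz: "1 - c * cnj v \<noteq> 0" "1 - cnj c * z \<noteq> 0"
    using one_minus_cnj_mult_nonzero[OF v, of c] one_minus_cnj_mult_nonzero[OF c, of z] c z
    by (auto simp: mult.commute)
  have "cnj (\<phi> v) * \<phi> z = (cnj l * l) * ((cnj v - cnj c) * (z - c)) / ((1 - c * cnj v) * (1 - cnj c * z))"
    using assms by (simp add: disk_moebius_on_def)
  then have "1 - cnj (\<phi> v) * \<phi> z
      = ((1 - c * cnj v) * (1 - cnj c * z) - (cnj v - cnj c) * (z - c)) / ((1 - c * cnj v) * (1 - cnj c * z))"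
    using nz by (simp add: l diff_divide_distrib)
  also have "(1 - c * cnj v) * (1 - cnj c * z) - (cnj v - cnj c) * (z - c)
      = (1 - c * cnj c) * (1 - cnj v * z)"
    by (simp add: algebra_simps)
  finally show ?thesis .
qed

lemma disk_moebius_norm_less_one:
  assumes "disk_moebius_on l c \<phi>" "cmod z < 1"
  shows "cmod (\<phi> z) < 1"
  using Moebius_function_norm_lt_1[of c z 0] assms
  by (auto simp: disk_moebius_on_def Moebius_function_def norm_mult norm_divide)

lemma disk_moebius_inverse:
  assumes \<phi>: "disk_moebius_on l c \<phi>"
    and \<psi>: "\<And>z. z \<in> unit_disk \<Longrightarrow> \<psi> z \<in> unit_disk \<and> \<phi> (\<psi> z) = z"
  shows "disk_moebius_on (cnj l) (- l * c) \<psi>"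
  unfolding disk_moebius_on_def
proof (intro conjI ballI)
  have c: "cmod c < 1" and l1: "cmod l = 1" and l: "cnj l * l = 1" "l * cnj l = 1"
    using \<phi> complex_norm_square[of l] by (auto simp: disk_moebius_on_def mult.commute)
  show "cmod (cnj l) = 1" "cmod (- l * c) < 1"
    using c l1 by (auto simp: norm_mult)
  fix z assume z: "z \<in> unit_disk"
  define y where "y = \<psi> z"
  have y: "cmod y < 1" "\<phi> y = z" using \<psi>[OF z] by (auto simp: y_def)
  have nz: "1 - cnj c * y \<noteq> 0" "1 - cnj (- l * c) * z \<noteq> 0"
    using one_minus_cnj_mult_nonzero[of c y] one_minus_cnj_mult_nonzero[of "- l * c" z] y z c l1
    by (simp_all add: norm_mult)
  have "z * (1 - cnj c * y) = l * (y - c)"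
    using \<phi> y nz by (auto simp: disk_moebius_on_def)
  then have "cnj l * (z * (1 - cnj c * y)) = (cnj l * l) * (y - c)"
    by simp
  then have "cnj l * z - cnj l * z * cnj c * y = y - c"
    unfolding l by (simp add: algebra_simps)
  then have "y * (1 - cnj (- l * c) * z) = cnj l * z + c"
    by (simp add: algebra_simps)
  also have "\<dots> = cnj l * z + (cnj l * l) * c"
    by (simp add: l)
  also have "\<dots> = cnj l * (z - - l * c)"
    by (simp add: algebra_simps)
  finally show "\<psi> z = cnj l * (z - - l * c) / (1 - cnj (- l * c) * z)"
    using nz(2) unfolding y_def[symmetric] by (simp add: eq_divide_eq)
qed

text \<open>Here \<open>- l\<close> is the quotient of \<open>\<phi> 0\<close> by \<open>c\<close>,
  and its square root \<open>s\<close> measures half the angle between these points. The hypothesis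
  on \<open>\<phi> (\<phi> 0)\<close> forces the real part of \<open>- l\<close> to be
  \<open>(1 + |c|^2) / 2\<close>, strictly between 0 and 1, so \<open>s\<close> lies on neither
  axis.\<close>

lemma disk_moebius_order_3_multiplier:
  assumes \<phi>: "disk_moebius_on l c \<phi>" and c: "c \<noteq> 0" and \<phi>\<phi>: "\<phi> (\<phi> 0) = c"
  obtains s where "s\<^sup>2 = - l" "cmod s = 1" "Re s \<noteq> 0" "Im s \<noteq> 0"
proof -
  have c1: "cmod c < 1" and l1: "cmod l = 1" and l: "cnj l * l = 1"
    using \<phi> complex_norm_square[of l] by (auto simp: disk_moebius_on_def mult.commute)
  have \<phi>0: "\<phi> 0 = - l * c"
    using \<phi> by (simp add: disk_moebius_on_def)
  have b: "cmod (- l * c) < 1" using c1 l1 by (simp add: norm_mult)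
  then have "l * (- l * c - c) = c * (1 - cnj c * (- l * c))"
    using \<phi> \<phi>\<phi> \<phi>0 one_minus_cnj_mult_nonzero[OF c1, of "- l * c"]
    by (auto simp: disk_moebius_on_def divide_eq_eq)
  moreover have "c * (l * l + l + 1 + l * (c * cnj c))
      = c * (1 - cnj c * (- l * c)) - l * (- l * c - c)"
    by (simp add: algebra_simps)
  ultimately have "c * (l * l + l + 1 + l * (c * cnj c)) = 0" by simp
  \<comment> \<open>Multiplying by \<open>cnj l\<close> makes the quadratic equation for
    \<open>l\<close> a real linear equation for \<open>Re l\<close>.\<close>
  then have "cnj l * (l * l + l + 1 + l * (c * cnj c)) = 0" using c by simp
  then have "(cnj l * l) * l + cnj l * l + cnj l + (cnj l * l) * (c * cnj c) = 0"
    by (simp add: algebra_simps)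
  then have "l + cnj l + 1 + c * cnj c = 0"
    unfolding l by (simp add: algebra_simps)
  then have "l + cnj l + 1 + complex_of_real ((cmod c)\<^sup>2) = 0"
    unfolding complex_norm_square .
  then have "complex_of_real (2 * Re l + 1 + (cmod c)\<^sup>2) = 0"
    unfolding complex_add_cnj by simp
  then have Re: "2 * Re l + 1 + (cmod c)\<^sup>2 = 0"
    by (simp only: of_real_eq_0_iff)
  define s where "s = csqrt (- l)"
  have s: "s\<^sup>2 = - l" by (simp add: s_def)
  then have "(cmod s)\<^sup>2 = 1" using l1 by (metis norm_minus_cancel norm_power)
  then have s1: "cmod s = 1" using norm_ge_zero[of s] unfolding power2_eq_1_iff by linarith
  have "(Re s)\<^sup>2 - (Im s)\<^sup>2 = - Re l"
    using arg_cong[OF s, of Re] by (simp add: power2_eq_square)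
  moreover have "(Re s)\<^sup>2 + (Im s)\<^sup>2 = 1"
    using s1 cmod_power2[of s] by simp
  moreover have "(cmod c)\<^sup>2 < 1" using c1 by (simp add: abs_square_less_1)
  ultimately have "(Re s)\<^sup>2 \<noteq> 0" "(Im s)\<^sup>2 \<noteq> 0"
    using Re zero_le_power2[of "cmod c"] by linarith+
  then show thesis
    using that[OF s s1] by simp
qed


section \<open>Composition operators and their adjoints\<close>

text \<open>By \<open>disk_moebius_kernel\<close> the composed kernel is a multiple of
  \<open>(1 - cnj c * z) * szego v z\<close>. Naming the kernel point \<open>\<phi> v\<close> avoids
  any reference to an inverse map.\<close>

lemma hardy_series_composition_szego:
  assumes \<phi>: "disk_moebius_on l c \<phi>" and v: "cmod v < 1"
  shows "hardy_series (composition_operator \<phi> (szego (\<phi> v)))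
    (\<lambda>n. (1 - c * cnj v) / (1 - c * cnj c)
      * (cnj v ^ n + - cnj c * (if n = 0 then 0 else cnj v ^ (n - 1))))"
proof -
  let ?k = "(1 - c * cnj v) / (1 - c * cnj c)"
  have "composition_operator \<phi> (szego (\<phi> v)) = (\<lambda>z. ?k * (szego v z + - cnj c * (z * szego v z)))"
  proof
    fix z
    show "composition_operator \<phi> (szego (\<phi> v)) z = ?k * (szego v z + - cnj c * (z * szego v z))"
    proof (cases "cmod z < 1")
      case True
      then have "composition_operator \<phi> (szego (\<phi> v)) z = 1 / (1 - cnj (\<phi> v) * \<phi> z)"
        using disk_moebius_norm_less_one[OF \<phi>] by (simp add: composition_operator_def szego_def)
      also have "\<dots> = ?k * ((1 - cnj c * z) / (1 - cnj v * z))"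
        unfolding disk_moebius_kernel[OF \<phi> v True] by simp
      finally show ?thesis
        using True by (simp add: szego_def diff_divide_distrib)
    qed (simp add: composition_operator_def szego_def)
  qed
  then show ?thesis
    by (simp only:) (intro hardy_series_cmult hardy_series_add hardy_series_shift hardy_series_szego v)
qed

lemma hardy_inner_szego_self:
  assumes "cmod w < 1"
  shows "hardy_inner (szego w) (szego w) = 1 / (1 - cnj w * w)"
  using hardy_inner_szego[of "szego w" w] hardy_series_szego[OF assms] assms
  by (auto simp: hardy_space_iff szego_def)

text \<open>The real factor is the harmonic extension to \<open>w\<close> of the Poisson kernel at
  \<open>b\<close>: it is the real part of \<open>(1 + cnj b * w) / (1 - cnj b * w)\<close>.\<close>

lemma hardy_inner_composition_szego:
  assumes \<phi>: "disk_moebius_on l c \<phi>" and v: "cmod v < 1"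
  defines "b \<equiv> - l * c" and "w \<equiv> \<phi> v"
  shows "hardy_inner (composition_operator \<phi> (szego w)) (composition_operator \<phi> (szego w))
    = hardy_inner (szego w) (szego w) * complex_of_real (2 * Re (1 / (1 - cnj b * w)) - 1)"
proof -
  define D where "D = 1 - c * cnj c"
  define k where "k = (1 - c * cnj v) / D"
  define A where "A n = k * (cnj v ^ n + - cnj c * (if n = 0 then 0 else cnj v ^ (n - 1)))" for n
  have c: "cmod c < 1" and l: "cnj l * l = 1"
    using assms(1) complex_norm_square[of l] by (auto simp: disk_moebius_on_def mult.commute)
  have nz: "D \<noteq> 0" "1 - c * cnj v \<noteq> 0" "1 - cnj c * v \<noteq> 0" "1 - v * cnj v \<noteq> 0"
    using one_minus_cnj_mult_nonzero[OF c, of c] one_minus_cnj_mult_nonzero[OF v, of c]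
      one_minus_cnj_mult_nonzero[OF c, of v] one_minus_cnj_mult_nonzero[OF v, of v] c v
    by (auto simp: mult.commute D_def)
  have A: "hardy_series (composition_operator \<phi> (szego w)) A"
    unfolding A_def k_def D_def w_def by (rule hardy_series_composition_szego[OF \<phi> v])
  have "(\<lambda>n. A n * cnj (A n)) sums hardy_inner (composition_operator \<phi> (szego w)) (composition_operator \<phi> (szego w))"
    by (rule hardy_inner_series[OF A A])
  moreover have "(\<lambda>n. A n * cnj (A n)) sums
      (k * cnj k * ((cnj v - cnj c) * (v - c)) * (1 / (1 - v * cnj v)) + A 0 * cnj (A 0))"
  \<comment> \<open>From index 1 on the coefficients are geometric with factor
    \<open>cnj v - cnj c\<close>; index 0 is an exception because the shifted sequence starts with
    0.\<close>
  proof (rule sums_Suc)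
    have "cmod (v * cnj v) < 1"
      using norm_mult_less[of v 1 "cnj v" 1] v by simp
    from sums_mult[OF geometric_sums[OF this], of "k * cnj k * ((cnj v - cnj c) * (v - c))"]
    show "(\<lambda>n. A (Suc n) * cnj (A (Suc n))) sums
        (k * cnj k * ((cnj v - cnj c) * (v - c)) * (1 / (1 - v * cnj v)))"
      by (simp add: A_def algebra_simps)
  qed
  ultimately have "hardy_inner (composition_operator \<phi> (szego w)) (composition_operator \<phi> (szego w))
      = k * cnj k * ((cnj v - cnj c) * (v - c)) * (1 / (1 - v * cnj v)) + A 0 * cnj (A 0)"
    by (rule sums_unique2)
  also have "\<dots> = k * cnj k * ((cnj v - cnj c) * (v - c) + (1 - v * cnj v)) / (1 - v * cnj v)"
    using nz by (simp add: A_def field_simps)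
  also have "(cnj v - cnj c) * (v - c) + (1 - v * cnj v) = (1 - cnj c * v) + (1 - c * cnj v) - D"
    by (simp add: D_def algebra_simps)
  also have "k * cnj k * ((1 - cnj c * v) + (1 - c * cnj v) - D) / (1 - v * cnj v)
      = ((1 - c * cnj v) * (1 - cnj c * v) / (D * (1 - v * cnj v)))
        * ((1 - cnj c * v) / D + (1 - c * cnj v) / D - 1)"
  proof -
    have k': "cnj k = (1 - cnj c * v) / D"
      by (simp add: k_def D_def mult.commute)
    have "p / D * (q / D) * (q + p - D) / R = p * q / (D * R) * (q / D + p / D - 1)"
      if "R \<noteq> 0" for p q R
      using that nz(1) by (simp add: field_simps)
    then show ?thesis
      unfolding k' unfolding k_def using nz(4) .
  qed
  also have "(1 - c * cnj v) * (1 - cnj c * v) / (D * (1 - v * cnj v)) = hardy_inner (szego w) (szego w)"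
    unfolding w_def hardy_inner_szego_self[OF disk_moebius_norm_less_one[OF \<phi> v]]
      disk_moebius_kernel[OF \<phi> v v] by (simp add: D_def mult.commute)
  \<comment> \<open>What remains still depends on \<open>v\<close>; this passes to the kernel point
    \<open>w\<close>.\<close>
  also have "(1 - cnj c * v) / D = 1 / (1 - cnj b * w)"
  proof -
    have "1 - cnj b * w = 1 + (cnj l * l) * cnj c * (v - c) / (1 - cnj c * v)"
      using \<phi> v by (simp add: b_def w_def disk_moebius_on_def)
    also have "\<dots> = D / (1 - cnj c * v)"
      unfolding l using nz by (simp add: D_def field_simps)
    finally show ?thesis by simp
  qed
  also have "(1 - c * cnj v) / D = cnj (1 / (1 - cnj b * w))"
    unfolding \<open>(1 - cnj c * v) / D = 1 / (1 - cnj b * w)\<close>[symmetric] by (simp add: D_def mult.commute)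
  also have "1 / (1 - cnj b * w) + cnj (1 / (1 - cnj b * w)) - 1 = complex_of_real (2 * Re (1 / (1 - cnj b * w)) - 1)"
    unfolding complex_add_cnj by simp
  finally show ?thesis .
qed

section \<open>The adjoint of a composition operator and the backward shift\<close>

text \<open>The numerical radius of the backward shift is at most 1, by the arithmetic-geometric
  mean inequality applied termwise.\<close>

lemma backward_shift_sums:
  assumes "hardy_series g G"
  shows "summable (\<lambda>n. G (Suc n) * cnj (G n))"
    and "cmod (\<Sum>n. G (Suc n) * cnj (G n)) \<le> (\<Sum>n. (cmod (G n))\<^sup>2)"
proof -
  have s: "summable (\<lambda>n. (cmod (G n))\<^sup>2)" and s': "summable (\<lambda>n. (cmod (G (Suc n)))\<^sup>2)"
    using assms summable_Suc_iff[of "\<lambda>n. (cmod (G n))\<^sup>2"] by (auto simp: hardy_series_def)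
  have le: "norm (G (Suc n) * cnj (G n)) \<le> ((cmod (G n))\<^sup>2 + (cmod (G (Suc n)))\<^sup>2) / 2" for n
    using sum_squares_bound[of "cmod (G n)" "cmod (G (Suc n))"] by (simp add: norm_mult mult_ac)
  have sum: "summable (\<lambda>n. ((cmod (G n))\<^sup>2 + (cmod (G (Suc n)))\<^sup>2) / 2)"
    by (intro summable_divide summable_add s s')
  then have n: "summable (\<lambda>n. norm (G (Suc n) * cnj (G n)))"
    using le by (rule summable_norm_comparison_test[OF exI, OF allI, OF impI, rotated])
  then show "summable (\<lambda>n. G (Suc n) * cnj (G n))"
    by (rule summable_norm_cancel)
  have "cmod (\<Sum>n. G (Suc n) * cnj (G n)) \<le> (\<Sum>n. norm (G (Suc n) * cnj (G n)))"
    by (rule summable_norm[OF n])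
  also have "\<dots> \<le> (\<Sum>n. ((cmod (G n))\<^sup>2 + (cmod (G (Suc n)))\<^sup>2) / 2)"
    using le n sum by (rule suminf_le)
  also have "\<dots> = ((\<Sum>n. (cmod (G n))\<^sup>2) + (\<Sum>n. (cmod (G (Suc n)))\<^sup>2)) / 2"
    using s s' by (simp add: suminf_divide suminf_add[symmetric] summable_add)
  also have "\<dots> \<le> (\<Sum>n. (cmod (G n))\<^sup>2)"
    using suminf_split_head[OF s] by simp
  finally show "cmod (\<Sum>n. G (Suc n) * cnj (G n)) \<le> (\<Sum>n. (cmod (G n))\<^sup>2)" .
qed

text \<open>Pair \<open>S g\<close> with the kernel at \<open>\<phi> z\<close> and move the operator
  to the kernel, whose coefficients are known. \<open>Bg\<close> is the backward shift of
  \<open>g\<close>; it appears because the adjoint of multiplication by the variable acts on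
  \<open>g\<close>.\<close>

lemma composition_adjoint_formula:
  assumes \<phi>: "disk_moebius_on l c \<phi>"
    and adj: "is_adjoint_on hardy_space hardy_inner (composition_operator \<phi>) S"
    and g: "hardy_series g G" and Bg: "hardy_series Bg (\<lambda>n. G (Suc n))" and z: "cmod z < 1"
  shows "S g (\<phi> z) = (1 - cnj c * z) / (1 - c * cnj c) * (g z - c * Bg z)"
proof -
  let ?k = "(1 - c * cnj z) / (1 - c * cnj c)"
  let ?A = "\<lambda>n. ?k * (cnj z ^ n + - cnj c * (if n = 0 then 0 else cnj z ^ (n - 1)))"
  have \<phi>z: "cmod (\<phi> z) < 1" by (rule disk_moebius_norm_less_one[OF \<phi> z])
  have H: "g \<in> hardy_space" "szego (\<phi> z) \<in> hardy_space" "S g \<in> hardy_space"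
    using g hardy_series_szego[OF \<phi>z] adj by (auto simp: hardy_space_iff is_adjoint_on_def)
  have "S g (\<phi> z) = hardy_inner (S g) (szego (\<phi> z))"
    using H(3) \<phi>z by (simp add: hardy_inner_szego)
  also have "\<dots> = cnj (hardy_inner (szego (\<phi> z)) (S g))"
    by (rule hardy_inner_commute[OF H(2,3)])
  also have "\<dots> = cnj (hardy_inner (composition_operator \<phi> (szego (\<phi> z))) g)"
    using adj H by (simp add: is_adjoint_on_def)
  finally have eq: "S g (\<phi> z) = cnj (hardy_inner (composition_operator \<phi> (szego (\<phi> z))) g)" .
  have "(\<lambda>n. cnj (?A n * cnj (G n))) sums cnj (hardy_inner (composition_operator \<phi> (szego (\<phi> z))) g)"
    unfolding sums_cnj by (rule hardy_inner_series[OF hardy_series_composition_szego[OF \<phi> z] g])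
  moreover have "(\<lambda>n. cnj (?A n * cnj (G n))) sums (cnj ?k * (g z + - c * Bg z))"
  proof -
    have "(\<lambda>n. G n * z ^ n) sums g z"
      using g z by (simp add: hardy_series_def)
    moreover have "(\<lambda>n. (if n = 0 then 0 else z ^ (n - 1)) * G n) sums Bg z"
      by (rule sums_Suc_imp) (use Bg z in \<open>simp_all add: hardy_series_def mult.commute\<close>)
    ultimately have "(\<lambda>n. cnj ?k * (G n * z ^ n + - c * ((if n = 0 then 0 else z ^ (n - 1)) * G n)))
        sums (cnj ?k * (g z + - c * Bg z))"
      by (intro sums_mult sums_add)
    also have "(\<lambda>n. cnj ?k * (G n * z ^ n + - c * ((if n = 0 then 0 else z ^ (n - 1)) * G n)))
        = (\<lambda>n. cnj (?A n * cnj (G n)))"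
      by (auto simp: fun_eq_iff algebra_simps)
    finally show ?thesis .
  qed
  ultimately show ?thesis
    unfolding eq by (simp add: sums_unique2 mult.commute)
qed

text \<open>
  Only the last term of the right-hand side distinguishes \<open>\<phi>\<close> from \<open>\<phi>\<^sup>-\<^sup>1\<close>, whose zero has the
  same modulus.
\<close>

lemma hardy_inner_composition_adjoint:
  assumes \<phi>: "disk_moebius_on l c \<phi>"
    and adj: "is_adjoint_on hardy_space hardy_inner (composition_operator \<phi>) S"
    and g: "hardy_series g G"
  defines "P \<equiv> \<Sum>n. G (Suc n) * cnj (G n)"
  shows "(1 - c * cnj c) * hardy_inner (S g) (S g)
    = (1 + c * cnj c) * hardy_inner g g - c * cnj c * (G 0 * cnj (G 0)) - (c * P + cnj (c * P))"
proof -
  let ?D = "1 - c * cnj c"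
  let ?E = "\<lambda>n. G n + - c * G (Suc n)"
  \<comment> \<open>The inner product of \<open>S g\<close> with itself equals that of
    \<open>h\<close> with \<open>g\<close>, and the adjoint formula gives \<open>h\<close>
    explicitly.\<close>
  define h where "h = composition_operator \<phi> (S g)"
  have c: "cmod c < 1" using \<phi> by (simp add: disk_moebius_on_def)
  have D: "?D \<noteq> 0"
    using one_minus_cnj_mult_nonzero[OF c, of c] c by (auto simp: mult.commute)
  have "summable (\<lambda>n. (cmod (G (Suc n)))\<^sup>2)"
    using g summable_Suc_iff[of "\<lambda>n. (cmod (G n))\<^sup>2"] by (simp add: hardy_series_def)
  then obtain Bg where Bg: "hardy_series Bg (\<lambda>n. G (Suc n))"
    by (rule hardy_series_exists)
  have E: "hardy_series (\<lambda>z. g z + - c * Bg z) ?E"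
    by (intro hardy_series_add hardy_series_cmult g Bg)
  have "h = (\<lambda>z. 1 / ?D * ((g z + - c * Bg z) + - cnj c * (z * (g z + - c * Bg z))))"
  proof
    fix z
    show "h z = 1 / ?D * ((g z + - c * Bg z) + - cnj c * (z * (g z + - c * Bg z)))"
    proof (cases "cmod z < 1")
      case True
      then have "h z = (1 - cnj c * z) / ?D * (g z - c * Bg z)"
        by (simp add: h_def composition_operator_def composition_adjoint_formula[OF \<phi> adj g Bg])
      also have "\<dots> = 1 / ?D * ((g z + - c * Bg z) + - cnj c * (z * (g z + - c * Bg z)))"
        unfolding times_divide_eq_left mult_1 by (rule arg_cong[where f = "\<lambda>x. x / ?D"]) (simp add: algebra_simps)
      finally show ?thesis .
    next
      case False
      then show ?thesis
        using g Bg by (simp add: h_def composition_operator_def hardy_series_def)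
    qed
  qed
  then have h: "hardy_series h (\<lambda>n. 1 / ?D * (?E n + - cnj c * (if n = 0 then 0 else ?E (n - 1))))"
    by (simp only:) (intro hardy_series_cmult hardy_series_add hardy_series_shift E)
  have gH: "g \<in> hardy_space" and SH: "S g \<in> hardy_space"
    using g adj by (auto simp: hardy_space_iff is_adjoint_on_def)
  have N: "(\<lambda>n. G n * cnj (G n)) sums hardy_inner g g"
    by (rule hardy_inner_series[OF g g])
  have P: "(\<lambda>n. G (Suc n) * cnj (G n)) sums P"
    unfolding P_def by (rule summable_sums[OF backward_shift_sums(1)[OF g]])
  have P': "(\<lambda>n. G n * cnj (G (Suc n))) sums cnj P"
    using sums_cnj[THEN iffD2, OF P] by (simp add: mult.commute)
  have N': "(\<lambda>n. G (Suc n) * cnj (G (Suc n))) sums (hardy_inner g g - G 0 * cnj (G 0))"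
    using N by (subst sums_Suc_iff) simp
  have "(\<lambda>n. ?E n * cnj (G n)) sums (hardy_inner g g + - c * P)"
    using sums_add[OF N sums_mult[OF P, of "- c"]] by (simp add: algebra_simps)
  \<comment> \<open>Index 0 contributes nothing, so only coefficients of \<open>g\<close> from index
    1 on are met; this is the origin of the \<open>G 0\<close> term in the result.\<close>
  moreover have "(\<lambda>n. (if n = 0 then 0 else ?E (n - 1)) * cnj (G n)) sums
      (cnj P + - c * (hardy_inner g g - G 0 * cnj (G 0)))"
    by (rule sums_Suc_imp)
       (use sums_add[OF P' sums_mult[OF N', of "- c"]] in \<open>simp_all add: algebra_simps\<close>)
  ultimately have "(\<lambda>n. 1 / ?D * (?E n * cnj (G n) + - cnj c * ((if n = 0 then 0 else ?E (n - 1)) * cnj (G n)))) sums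
      (1 / ?D * ((hardy_inner g g + - c * P) + - cnj c * (cnj P + - c * (hardy_inner g g - G 0 * cnj (G 0)))))"
    by (intro sums_mult sums_add)
  also have "(\<lambda>n. 1 / ?D * (?E n * cnj (G n) + - cnj c * ((if n = 0 then 0 else ?E (n - 1)) * cnj (G n))))
      = (\<lambda>n. 1 / ?D * (?E n + - cnj c * (if n = 0 then 0 else ?E (n - 1))) * cnj (G n))"
    by (simp only: distrib_right mult.assoc)
  finally have hg: "hardy_inner h g
      = 1 / ?D * ((hardy_inner g g + - c * P) + - cnj c * (cnj P + - c * (hardy_inner g g - G 0 * cnj (G 0))))"
    using hardy_inner_series[OF h g] by (rule sums_unique2[symmetric])
  have Sg: "hardy_inner (S g) (S g) = hardy_inner h g"
    using adj gH SH by (simp add: is_adjoint_on_def h_def)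
  have cancel: "?D * (1 / ?D * x) = x" for x
    using D by simp
  show ?thesis
    unfolding Sg hg cancel by (simp add: algebra_simps)
qed


section \<open>The difference of two Poisson kernels\<close>

lemma Re_inverse_one_minus_unit:
  assumes "cmod w = 1"
  shows "Re (1 / (1 - cnj c * w)) = (1 - Re (cnj c * w)) / (1 + (cmod c)\<^sup>2 - 2 * Re (cnj c * w))"
proof -
  have "(cmod (1 - z))\<^sup>2 = 1 + (cmod z)\<^sup>2 - 2 * Re z" for z
    unfolding cmod_power2 by (simp add: power2_eq_square algebra_simps)
  from this[of "cnj c * w"] assms
  have "(cmod (1 - cnj c * w))\<^sup>2 = 1 + (cmod c)\<^sup>2 - 2 * Re (cnj c * w)"
    by (simp add: norm_mult)
  then show ?thesis
    unfolding Re_divide cmod_power2[symmetric] by simp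
qed

text \<open>Up to the rotation \<open>u\<close> the points \<open>b\<close> and \<open>c\<close> are
  the conjugates \<open>p + iq\<close> and \<open>p - iq\<close>, so the bound is
  \<open>4 |q| / (1 - r^2)\<close>. That \<open>q\<close> is nonzero keeps the difference from
  vanishing; that \<open>p\<close> is nonzero gives \<open>y < 1\<close> and hence
  strictness.\<close>

lemma poisson_difference_on_circle:
  assumes s: "cmod s = 1" "Re s \<noteq> 0" "Im s \<noteq> 0" and u: "cmod u = 1" and r: "0 < r" "r < 1"
  defines "b \<equiv> of_real r * u * s" and "c \<equiv> of_real r * u * cnj s"
  obtains w where "cmod w = 1"
    "\<bar>2 * Re (1 / (1 - cnj c * w) - 1 / (1 - cnj b * w))\<bar> > 2 * cmod (c - b) / (1 - r\<^sup>2)"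
proof -
  define p q where "p = r * Re s" and "q = r * Im s"
  have pq: "p\<^sup>2 + q\<^sup>2 = r\<^sup>2" "p \<noteq> 0" "q \<noteq> 0"
    using s r cmod_power2[of s] by (auto simp: p_def q_def power_mult_distrib simp flip: distrib_left)
  have r1: "1 - r\<^sup>2 > 0" "1 + r\<^sup>2 > 0" using r by (auto simp: power_less_one_iff abs_if intro: add_pos_nonneg)
  \<comment> \<open>With this real part the product of the two denominators collapses to
    \<open>(1 - r\<^sup>2)\<^sup>2 y\<^sup>2\<close>, and the difference of the Poisson kernels exceeds the bound by the factor \<open>1 / y\<close>.\<close>
  define x where "x = 2 * p / (1 + r\<^sup>2)"
  have "4 * p\<^sup>2 < (1 + r\<^sup>2)\<^sup>2"
  proof -
    have "4 * p\<^sup>2 \<le> 4 * r\<^sup>2" using pq(1) zero_le_power2[of q] by linarith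
    also have "4 * r\<^sup>2 < (1 + r\<^sup>2)\<^sup>2" using zero_less_power[OF r1(1), of 2] by (simp add: power2_eq_square algebra_simps)
    finally show ?thesis .
  qed
  then have x: "x\<^sup>2 < 1" "x\<^sup>2 > 0"
    using r1 pq by (auto simp: x_def power_divide power_mult_distrib)
  define y where "y = sqrt (1 - x\<^sup>2)"
  have y: "0 < y" "y < 1" "y\<^sup>2 = 1 - x\<^sup>2" using x by (auto simp: y_def real_sqrt_lt_1_iff)
  define w where "w = u * Complex x y"
  have w: "cmod w = 1" 
    unfolding w_def norm_mult u using y by (simp add: cmod_def)
  have uu: "u * cnj u = 1" using u by (simp add: complex_norm_square[symmetric])
  have "cnj b * w = (u * cnj u) * (Complex p (-q) * Complex x y)"
    by (simp add: b_def w_def p_def q_def complex_eq_iff algebra_simps)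
  then have bw: "Re (cnj b * w) = p * x + q * y" by (simp add: uu)
  have "cnj c * w = (u * cnj u) * (Complex p q * Complex x y)"
    by (simp add: c_def w_def p_def q_def complex_eq_iff algebra_simps)
  then have cw: "Re (cnj c * w) = p * x - q * y" by (simp add: uu)
  have nb: "cmod b = r" "cmod c = r" using s u r by (auto simp: b_def c_def norm_mult)
  \<comment> \<open>The squared moduli of \<open>1 - cnj c * w\<close> and
    \<open>1 - cnj b * w\<close> are \<open>X + 2 * q * y\<close> and
    \<open>X - 2 * q * y\<close>.\<close>
  define X where "X = 1 + r\<^sup>2 - 2 * p * x"
  have prod: "(X + 2 * q * y) * (X - 2 * q * y) = (1 - r\<^sup>2)\<^sup>2 * y\<^sup>2"
  proof -
    \<comment> \<open>The choice of \<open>x\<close> makes \<open>X\<close> and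
      \<open>y\<^sup>2\<close>, cleared of denominators, the same expression, which then factors out
      of the product.\<close>
    have X: "X * (1 + r\<^sup>2) = (1 + r\<^sup>2)\<^sup>2 - 4 * p\<^sup>2"
      using r1 by (simp add: X_def x_def field_simps power2_eq_square)
    have Y: "y\<^sup>2 * (1 + r\<^sup>2)\<^sup>2 = (1 + r\<^sup>2)\<^sup>2 - 4 * p\<^sup>2"
      using r1 by (simp add: y x_def power_divide power_mult_distrib field_simps)
    have "(X\<^sup>2 - 4 * q\<^sup>2 * y\<^sup>2) * (1 + r\<^sup>2)\<^sup>2 = (X * (1 + r\<^sup>2))\<^sup>2 - 4 * q\<^sup>2 * (y\<^sup>2 * (1 + r\<^sup>2)\<^sup>2)"
      by (simp add: power2_eq_square algebra_simps)
    also have "\<dots> = (y\<^sup>2 * (1 + r\<^sup>2)\<^sup>2) * ((1 + r\<^sup>2)\<^sup>2 - 4 * p\<^sup>2 - 4 * q\<^sup>2)"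
      unfolding X Y by (simp add: power2_eq_square algebra_simps)
    also have "(1 + r\<^sup>2)\<^sup>2 - 4 * p\<^sup>2 - 4 * q\<^sup>2 = (1 - r\<^sup>2)\<^sup>2"
      using pq(1) by (simp add: power2_eq_square algebra_simps)
    finally have "X\<^sup>2 - 4 * q\<^sup>2 * y\<^sup>2 = (1 - r\<^sup>2)\<^sup>2 * y\<^sup>2"
      using r1 by simp
    then show ?thesis by (simp add: power2_eq_square algebra_simps)
  qed
  then have nz: "X + 2 * q * y \<noteq> 0" "X - 2 * q * y \<noteq> 0" using r1 y(1) by auto
  have "2 * Re (1 / (1 - cnj c * w) - 1 / (1 - cnj b * w))
      = 2 * ((1 - (p * x - q * y)) / (X + 2 * q * y) - (1 - (p * x + q * y)) / (X - 2 * q * y))"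
    unfolding minus_complex.simps Re_inverse_one_minus_unit[OF w] bw cw nb
    by (simp add: X_def algebra_simps)
  also have "\<dots> = 2 * ((1 - p * x + q * y) * (X - 2 * q * y) - (1 - p * x - q * y) * (X + 2 * q * y))
      / ((1 - r\<^sup>2)\<^sup>2 * y\<^sup>2)"
    unfolding prod[symmetric] using nz by (simp add: field_simps)
  also have "(1 - p * x + q * y) * (X - 2 * q * y) - (1 - p * x - q * y) * (X + 2 * q * y)
      = - (2 * q * y * (1 - r\<^sup>2))"
    by (simp add: X_def algebra_simps)
  also have "2 * - (2 * q * y * (1 - r\<^sup>2)) / ((1 - r\<^sup>2)\<^sup>2 * y\<^sup>2) = - (4 * q / ((1 - r\<^sup>2) * y))"
  proof -
    have "2 * - (2 * q * y * E) / (E\<^sup>2 * y\<^sup>2) = - (4 * q / (E * y))" if "E \<noteq> 0" for E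
      using that y(1) by (simp add: field_simps power2_eq_square)
    then show ?thesis using r1(1) by simp
  qed
  finally have eq: "\<bar>2 * Re (1 / (1 - cnj c * w) - 1 / (1 - cnj b * w))\<bar> = 4 * \<bar>q\<bar> / ((1 - r\<^sup>2) * y)"
    using r1 y by (simp add: abs_mult)
  have "c - b = u * (- 2 * \<i> * q)"
    by (simp add: c_def b_def q_def complex_eq_iff algebra_simps)
  then have "cmod (c - b) = 2 * \<bar>q\<bar>" using u by (simp add: norm_mult)
  then have "2 * cmod (c - b) / (1 - r\<^sup>2) = 4 * \<bar>q\<bar> / (1 - r\<^sup>2)" by simp
  also have "\<dots> < 4 * \<bar>q\<bar> / ((1 - r\<^sup>2) * y)"
    using r1 y pq by (intro divide_strict_left_mono) auto
  finally have "\<bar>2 * Re (1 / (1 - cnj c * w) - 1 / (1 - cnj b * w))\<bar> > 2 * cmod (c - b) / (1 - r\<^sup>2)"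
    unfolding eq .
  with w show thesis by (rule that)
qed

text \<open>Szego kernels need a point inside the disk; a strict inequality survives a small radial
  move inward.\<close>

lemma poisson_difference_in_disk:
  assumes b: "cmod b < 1" "cmod c < 1" and w: "cmod w = 1"
    and "\<bar>2 * Re (1 / (1 - cnj c * w) - 1 / (1 - cnj b * w))\<bar> > K"
  obtains v where "cmod v < 1" "\<bar>2 * Re (1 / (1 - cnj c * v) - 1 / (1 - cnj b * v))\<bar> > K"
proof -
  let ?F = "\<lambda>v. \<bar>2 * Re (1 / (1 - cnj c * v) - 1 / (1 - cnj b * v))\<bar>"
  have "((\<lambda>t. ?F (of_real t * w)) \<longlongrightarrow> ?F (of_real 1 * w)) (at_left (1::real))"
    using one_minus_cnj_mult_nonzero[OF b(1), of w] one_minus_cnj_mult_nonzero[OF b(2), of w] w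
    by (intro tendsto_intros) auto
  then have "\<forall>\<^sub>F t in at_left (1::real). ?F (of_real t * w) > K"
    using assms by (intro order_tendstoD) auto
  moreover have "\<forall>\<^sub>F t in at_left (1::real). t \<in> {0<..<1}"
    by (rule eventually_at_leftI[of 0]) auto
  ultimately have "\<forall>\<^sub>F t in at_left (1::real). t \<in> {0<..<1} \<and> ?F (of_real t * w) > K"
    by eventually_elim simp
  then obtain t where "t \<in> {0<..<1}" "?F (of_real t * w) > K"
    by (force dest!: eventually_happens)
  with that[of "of_real t * w"] w show thesis
    by (simp add: norm_mult)
qed


section \<open>Composition operators of order three\<close>

theorem theorem3p5:
  fixes \<phi> :: "complex \<Rightarrow> complex" and a :: complex
  assumes "elliptic_automorphism \<phi>"
    and "disk_order \<phi> = 3"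
    and "a \<in> unit_disk - {0}"
    and "\<phi> a = a"
  shows "\<not> complex_symmetric_on hardy_space hardy_inner (composition_operator \<phi>)"
proof
  assume "complex_symmetric_on hardy_space hardy_inner (composition_operator \<phi>)"
  then obtain C S where CS: "conjugation_on hardy_space hardy_inner C \<and>
      is_adjoint_on hardy_space hardy_inner (composition_operator \<phi>) S \<and>
      (\<forall>x\<in>hardy_space. composition_operator \<phi> x = C (S (C x)))"
    unfolding complex_symmetric_on_def by (elim exE) (rule that)
  note C = CS[THEN conjunct1] and S = CS[THEN conjunct2, THEN conjunct1]
    and TCS = CS[THEN conjunct2, THEN conjunct2, THEN bspec]
  have aut: "disk_automorphism \<phi>" and uniq: "\<exists>!z. z \<in> unit_disk \<and> \<phi> z = z"
    using assms(1) unfolding elliptic_automorphism_def by (rule conjunct1, rule conjunct2)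
  have \<phi>_disk: "\<phi> z \<in> unit_disk" if "z \<in> unit_disk" for z
    using aut that unfolding disk_automorphism_def bij_betw_def by blast
  let ?P = "\<lambda>n::nat. 0 < n \<and> (\<forall>z\<in>unit_disk. (\<phi> ^^ n) z = z)"
  have ex: "\<exists>n. ?P n" and least: "(LEAST n. ?P n) = 3"
    using assms(2) by (auto simp: disk_order_def numeral_eq_enat split: if_splits)
  have "?P 3" using LeastI_ex[OF ex] unfolding least .
  then have order3: "\<phi> (\<phi> (\<phi> z)) = z" if "z \<in> unit_disk" for z
    using that by (auto simp: numeral_3_eq_3)
  have \<phi>0: "\<phi> 0 \<noteq> 0"
  proof
    assume "\<phi> 0 = 0"
    then have "a = 0"
      using assms(3,4) by (intro Uniq_D[OF uniq[unfolded ex1_iff_ex_Uniq, THEN conjunct2]]) auto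
    then show False using assms(3) by simp
  qed
  \<comment> \<open>Order three makes this point the zero of \<phi>.\<close>
  define c where "c = \<phi> (\<phi> 0)"
  have c: "c \<in> unit_disk" "\<phi> c = 0"
    using \<phi>_disk order3[of 0] by (auto simp: c_def simp del: mem_ball)
  have c0: "c \<noteq> 0" using c(2) \<phi>0 by auto
  obtain l where \<phi>: "disk_moebius_on l c \<phi>"
    using disk_automorphism_eq_moebius[OF aut c] by blast
  then have l: "cmod l = 1" by (simp add: disk_moebius_on_def)
  define b where "b = - l * c"
  define \<psi> where "\<psi> = (\<lambda>z. \<phi> (\<phi> z))"
  have \<psi>: "disk_moebius_on (cnj l) b \<psi>"
    unfolding b_def \<psi>_def using \<phi>_disk order3 by (intro disk_moebius_inverse[OF \<phi>]) auto
  have ll: "cnj l * l = 1"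
    using l complex_norm_square[of l] by (simp add: mult.commute)
  \<comment> \<open>Passing to the inverse \<psi> exchanges the roles of \<open>b\<close> and
    \<open>c\<close>: the zero of \<psi> is \<open>b\<close> and its value at 0 is
    \<open>c\<close>.\<close>
  have cb: "c = - cnj l * b"
  proof -
    have "- cnj l * b = (cnj l * l) * c" by (simp add: b_def)
    then show ?thesis by (simp add: ll)
  qed
  obtain s where s: "s\<^sup>2 = - l" "cmod s = 1" "Re s \<noteq> 0" "Im s \<noteq> 0"
    using disk_moebius_order_3_multiplier[OF \<phi> c0] c_def by metis
  define r where "r = cmod c"
  have r: "0 < r" "r < 1" using c c0 by (auto simp: r_def)
  \<comment> \<open>The direction bisecting \<open>b\<close> and \<open>c\<close>, since
    \<open>b = s\<^sup>2 * c\<close>.\<close>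
  define u where "u = s * c / of_real r"
  have u: "cmod u = 1" using s r by (simp add: u_def norm_mult norm_divide r_def)
  have b_polar: "b = of_real r * u * s"
    unfolding b_def u_def s(1)[symmetric] power2_eq_square using r by simp
  have "of_real r * u * cnj s = (s * cnj s) * c"
    using r by (simp add: u_def)
  also have "s * cnj s = 1" using s(2) complex_norm_square[of s] by simp
  finally have c_polar: "c = of_real r * u * cnj s" by simp
  obtain w0 where w0: "cmod w0 = 1"
    "\<bar>2 * Re (1 / (1 - cnj c * w0) - 1 / (1 - cnj b * w0))\<bar> > 2 * cmod (c - b) / (1 - r\<^sup>2)"
    using poisson_difference_on_circle[OF s(2,3,4) u r] unfolding b_polar[symmetric] c_polar[symmetric] by blast
  have bc1: "cmod b < 1" "cmod c < 1" using \<phi> \<psi> by (auto simp: disk_moebius_on_def)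
  obtain w where w: "cmod w < 1"
    and gap: "\<bar>2 * Re (1 / (1 - cnj c * w) - 1 / (1 - cnj b * w))\<bar> > 2 * cmod (c - b) / (1 - r\<^sup>2)"
    using poisson_difference_in_disk[OF bc1 w0] by blast

  have CH: "C x \<in> hardy_space" "C (C x) = x" "hardy_inner (C x) (C x) = hardy_inner x x"
    if "x \<in> hardy_space" for x
    using that C unfolding conjugation_on_def by blast+
  have SH: "S x \<in> hardy_space" if "x \<in> hardy_space" for x
    using that S unfolding is_adjoint_on_def by blast
  \<comment> \<open>Invariance of the Hardy space is read off from the assumed factorization,
    without Littlewood subordination.\<close>
  have TH: "composition_operator \<phi> x \<in> hardy_space" if "x \<in> hardy_space" for x
    using that by (simp add: TCS CH SH)
  have TT: "composition_operator \<psi> x = composition_operator \<phi> (composition_operator \<phi> x)" for x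
    using \<phi>_disk by (auto simp: composition_operator_def \<psi>_def fun_eq_iff)
  have SS: "is_adjoint_on hardy_space hardy_inner (composition_operator \<psi>) (\<lambda>x. S (S x))"
    using S SH TH unfolding is_adjoint_on_def TT by simp
  define f where "f = szego w"
  have f: "f \<in> hardy_space"
    using hardy_series_szego[OF w] by (auto simp: f_def hardy_space_iff)
  define g where "g = C f"
  have g: "g \<in> hardy_space" using CH f by (simp add: g_def)
  obtain G where G: "hardy_series g G" using g by (auto simp: hardy_space_iff)
  define p where "p = (\<Sum>n. G (Suc n) * cnj (G n))"
  define N where "N = (\<Sum>n. (cmod (G n))\<^sup>2)"

  \<comment> \<open>The operator sends \<open>f\<close> to \<open>C (S g)\<close> and its square
    sends \<open>f\<close> to \<open>C (S (S g))\<close>, as the inner pair of conjugations cancels;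
    \<open>C\<close> preserves norms.\<close>
  have Tf: "hardy_inner (composition_operator \<phi> f) (composition_operator \<phi> f) = hardy_inner (S g) (S g)"
    using f g by (simp add: TCS CH SH g_def[symmetric])
  have TTf: "hardy_inner (composition_operator \<psi> f) (composition_operator \<psi> f)
      = hardy_inner (S (S g)) (S (S g))"
    using f g by (simp add: TT TH TCS[of "composition_operator \<phi> f"])
       (simp add: TCS CH SH g_def[symmetric])
  have gg: "hardy_inner g g = of_real N"
    using hardy_inner_series[OF G G] sums_of_real[OF summable_sums, of "\<lambda>n. (cmod (G n))\<^sup>2"] G
    unfolding N_def hardy_series_def by (auto simp: complex_norm_square[symmetric] simp del: of_real_power intro: sums_unique2)
  have ff: "hardy_inner f f = of_real N"
    using CH(3)[OF f] gg by (simp add: g_def)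
  have "N \<noteq> 0"
    using ff hardy_inner_szego_self[OF w] one_minus_cnj_mult_nonzero[OF w, of w] w by (auto simp: f_def)
  moreover have "N \<ge> 0" using G by (auto simp: N_def hardy_series_def intro!: suminf_nonneg)
  ultimately have N: "N > 0" by simp

  \<comment> \<open>The kernel formula is applied at the preimage of \<open>w\<close> under \<phi>,
    which is \<open>\<psi> w\<close>.\<close>
  have norm_S: "hardy_inner (S g) (S g) = of_real N * of_real (2 * Re (1 / (1 - cnj b * w)) - 1)"
  proof -
    have "\<phi> (\<psi> w) = w" "cmod (\<psi> w) < 1"
      using w order3[of w] disk_moebius_norm_less_one[OF \<psi> w] by (auto simp: \<psi>_def)
    then show ?thesis
      using hardy_inner_composition_szego[OF \<phi>, of "\<psi> w"] ff Tf by (simp add: b_def f_def)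
  qed
  have norm_SS: "hardy_inner (S (S g)) (S (S g)) = of_real N * of_real (2 * Re (1 / (1 - cnj c * w)) - 1)"
  proof -
    have "\<psi> (\<phi> w) = w" "cmod (\<phi> w) < 1"
      using w order3[of w] disk_moebius_norm_less_one[OF \<phi> w] by (auto simp: \<psi>_def)
    then show ?thesis
      using hardy_inner_composition_szego[OF \<psi>, of "\<phi> w"] ff TTf unfolding cb[symmetric] by (simp add: f_def)
  qed
  have rr: "c * cnj c = of_real (r\<^sup>2)" "b * cnj b = of_real (r\<^sup>2)"
    using l unfolding complex_norm_square[symmetric] by (simp_all add: b_def r_def norm_mult)
  \<comment> \<open>Since \<open>b\<close> and \<open>c\<close> have equal modulus, subtracting
    these two identities cancels everything but the terms in \<open>p\<close>.\<close>
  note adj1 = hardy_inner_composition_adjoint[OF \<phi> S G, folded p_def, unfolded rr]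
  note adj2 = hardy_inner_composition_adjoint[OF \<psi> SS G, folded p_def, unfolded rr]
  have "(1 - of_real (r\<^sup>2)) * (hardy_inner (S (S g)) (S (S g)) - hardy_inner (S g) (S g))
      = (c - b) * p + cnj ((c - b) * p)"
    unfolding right_diff_distrib adj1 adj2 by (simp add: algebra_simps)
  moreover have "(1 - of_real (r\<^sup>2)) * (hardy_inner (S (S g)) (S (S g)) - hardy_inner (S g) (S g))
      = complex_of_real ((1 - r\<^sup>2) * (N * (2 * Re (1 / (1 - cnj c * w) - 1 / (1 - cnj b * w)))))"
    unfolding norm_S norm_SS by (simp add: algebra_simps)
  ultimately have "cmod (complex_of_real ((1 - r\<^sup>2) * (N * (2 * Re (1 / (1 - cnj c * w) - 1 / (1 - cnj b * w))))))
      = cmod ((c - b) * p + cnj ((c - b) * p))" by simp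
  also have "\<dots> \<le> cmod ((c - b) * p) + cmod (cnj ((c - b) * p))"
    by (rule norm_triangle_ineq)
  also have "\<dots> = 2 * cmod (c - b) * cmod p"
    unfolding complex_mod_cnj norm_mult by simp
  also have "\<dots> \<le> 2 * cmod (c - b) * N"
    unfolding N_def p_def by (intro mult_left_mono backward_shift_sums(2)[OF G]) auto
  finally have "(1 - r\<^sup>2) * N * \<bar>2 * Re (1 / (1 - cnj c * w) - 1 / (1 - cnj b * w))\<bar> \<le> 2 * cmod (c - b) * N"
    unfolding norm_of_real abs_mult using N r by (simp add: abs_square_le_1 mult_ac)
  moreover have "1 - r\<^sup>2 > 0" using r by (simp add: abs_square_less_1)
  moreover from gap this N have "2 * cmod (c - b) * N
      < (1 - r\<^sup>2) * N * \<bar>2 * Re (1 / (1 - cnj c * w) - 1 / (1 - cnj b * w))\<bar>"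
    by (simp only: pos_divide_less_eq) (simp add: mult_ac)
  ultimately show False by simp
qed

end
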